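(* Let $b\colon L\to L$ be a monotone function on a complete lattice $L$. The companion $t$ of $b$ is given by $t(x)=\bigwedge\{b_i : i\in\mathrm{Ord},\ x\le b_i\}$.
   Context: The final sequence of $b$: $b_0=\top$, $b_{i+1}=b(b_i)$, $b_\lambda=\bigwedge_{i<\lambda}b_i$ for limit ordinals $\lambda$. The companion of $b$ is the greatest monotone function $t\colon L\to L$ such that $t\circ b\le b\circ t$ (pointwise), i.e. the final object of the category of distributive laws for $b$ viewed as a functor on the poset category $L$. *)

theory Defs
  imports Main
begin

text \<open>
  HOL has no type of all ordinals. \<open>'i ordinal\<close> is the type of order types of the well-orders
  whose field is a subset of the type \<open>'i\<close>, i.e. of all ordinals of cardinality at most that of
  \<open>'i\<close>. The relation \<open>ordIso\<close> only relates well-orders. For a lattice on the type \<open>'a\<close>, quantification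
  over all ordinals is rendered by the index type \<open>('a + 'i) ordinal\<close> with a free type variable
  \<open>'i\<close>: arbitrarily large segments of the ordinals, each containing every ordinal of cardinality
  at most that of the lattice.
\<close>

quotient_type 'i ordinal = "'i rel" / partial: "\<lambda>r s :: 'i rel. (r, s) \<in> ordIso"
proof (rule part_equivpI)
  have "Well_order ({} :: 'i rel)"
    by (simp add: well_order_on_def linear_order_on_def partial_order_on_def preorder_on_def)
  then show "\<exists>r :: 'i rel. (r, r) \<in> ordIso"
    using ordIso_reflexive by blast
qed (auto intro!: sympI transpI intro: ordIso_symmetric ordIso_transitive)

lemma Well_order_if_ordIso: "(r, r) \<in> ordIso \<Longrightarrow> Well_order r"
  by (simp add: ordIso_def)

lemma ordinal_cases:
  obtains r where "(r, r) \<in> ordIso" "x = abs_ordinal r"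
proof -
  have "\<exists>r. (r, r) \<in> ordIso \<and> x = abs_ordinal r"
  proof (induct x rule: ordinal.abs_induct)
    case (1 r)
    then show ?case by (intro exI[of _ r] conjI refl)
  qed
  with that show thesis by auto
qed

instantiation ordinal :: (type) wellorder
begin

lift_definition less_eq_ordinal :: "'i ordinal \<Rightarrow> 'i ordinal \<Rightarrow> bool"
  is "\<lambda>r s. (r, s) \<in> ordLeq"
  by (meson ordIso_ordLeq_trans ordLeq_ordIso_trans ordIso_symmetric)

lift_definition less_ordinal :: "'i ordinal \<Rightarrow> 'i ordinal \<Rightarrow> bool"
  is "\<lambda>r s. (r, s) \<in> ordLess"
  by (meson ordIso_ordLess_trans ordLess_ordIso_trans ordIso_symmetric)

instance
proof
  fix x y z :: "'i ordinal"
  show "x < y \<longleftrightarrow> x \<le> y \<and> \<not> y \<le> x"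
  proof transfer
    fix r s :: "'i rel"
    assume "(r, r) \<in> ordIso" "(s, s) \<in> ordIso"
    then have "Well_order r" "Well_order s"
      by (simp_all add: Well_order_if_ordIso)
    from not_ordLeq_iff_ordLess[OF this]
    show "(r, s) \<in> ordLess \<longleftrightarrow> (r, s) \<in> ordLeq \<and> (s, r) \<notin> ordLeq"
      using ordLess_imp_ordLeq by blast
  qed
  show "x \<le> x"
    by transfer (rule ordIso_imp_ordLeq)
  show "x \<le> y \<Longrightarrow> y \<le> z \<Longrightarrow> x \<le> z"
    by transfer (rule ordLeq_transitive)
  show "x \<le> y \<Longrightarrow> y \<le> x \<Longrightarrow> x = y"
    by transfer (simp add: ordIso_iff_ordLeq)
  show "x \<le> y \<or> y \<le> x"
    by transfer (simp add: Well_order_if_ordIso ordLeq_total)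
next
  fix P :: "'i ordinal \<Rightarrow> bool" and a :: "'i ordinal"
  assume step: "\<And>x. (\<And>y. y < x \<Longrightarrow> P y) \<Longrightarrow> P x"
  have "(r, r) \<in> ordIso \<longrightarrow> P (abs_ordinal r)" for r :: "'i rel"
  proof (induction r rule: wf_induct_rule[OF wf_ordLess])
    case (1 r)
    show ?case
    proof (rule impI, rule step)
      fix y
      assume r: "(r, r) \<in> ordIso" and "y < abs_ordinal r"
      moreover obtain s where s: "(s, s) \<in> ordIso" "y = abs_ordinal s"
        by (cases y rule: ordinal_cases)
      ultimately have "(s, r) \<in> ordLess"
        by (simp add: less_ordinal.abs_eq)
      then show "P y"
        using 1[of s] s by simp
    qed
  qed
  then show "P a"
    by (cases a rule: ordinal_cases) simp
qed

end

definition is_zero :: "'o::wellorder \<Rightarrow> bool" where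
  "is_zero i \<longleftrightarrow> (\<forall>j. i \<le> j)"

definition is_succ_of :: "'o::wellorder \<Rightarrow> 'o \<Rightarrow> bool" where
  "is_succ_of i j \<longleftrightarrow> j < i \<and> (\<forall>k. j < k \<longrightarrow> i \<le> k)"

definition is_limit :: "'o::wellorder \<Rightarrow> bool" where
  "is_limit i \<longleftrightarrow> \<not> is_zero i \<and> (\<nexists>j. is_succ_of i j)"

lemma is_succ_of_unique: "is_succ_of i j \<Longrightarrow> is_succ_of i j' \<Longrightarrow> j = j'"
  unfolding is_succ_of_def by (cases j j' rule: linorder_cases) (auto dest: leD)

lemma the_pred_eq: "is_succ_of i j \<Longrightarrow> (THE j. is_succ_of i j) = j"
  by (rule the_equality) (auto dest: is_succ_of_unique)

function final_seq :: "('a::complete_lattice \<Rightarrow> 'a) \<Rightarrow> 'o::wellorder \<Rightarrow> 'a" where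
  "final_seq b i =
    (if is_zero i then top
     else if \<exists>j. is_succ_of i j then b (final_seq b (THE j. is_succ_of i j))
     else INF j\<in>{..<i}. final_seq b j)"
  by pat_completeness auto
termination
proof (relation "inv_image {(j, i). j < i} snd")
  show "wf (inv_image {(j, i :: 'o::wellorder). j < i} (snd :: ('a \<Rightarrow> 'a) \<times> 'o \<Rightarrow> 'o))"
    by (intro wf_inv_image wf)
next
  fix b :: "'a::complete_lattice \<Rightarrow> 'a" and i :: "'o::wellorder"
  assume "\<exists>j. is_succ_of i j"
  then obtain j where "is_succ_of i j" by blast
  moreover from this have "j < i"
    unfolding is_succ_of_def by blast
  ultimately show "((b, THE j. is_succ_of i j), (b, i)) \<in> inv_image {(j, i). j < i} snd"
    by (simp add: the_pred_eq)
qed simp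

declare final_seq.simps [simp del]

lemma final_seq_zero: "is_zero i \<Longrightarrow> final_seq b i = top"
  by (subst final_seq.simps) (rule if_P)

lemma final_seq_succ:
  assumes "is_succ_of i j"
  shows "final_seq b i = b (final_seq b j)"
proof -
  have "\<not> is_zero i"
    using assms unfolding is_zero_def is_succ_of_def by (meson leD)
  moreover have "\<exists>j. is_succ_of i j"
    using assms by blast
  ultimately show ?thesis
    by (subst final_seq.simps) (simp only: the_pred_eq[OF assms] if_True if_False)
qed

lemma final_seq_limit:
  assumes "is_limit i"
  shows "final_seq b i = (INF j\<in>{..<i}. final_seq b j)"
proof -
  have "\<not> is_zero i" "\<not> (\<exists>j. is_succ_of i j)"
    using assms unfolding is_limit_def by blast+
  then show ?thesis
    by (subst final_seq.simps) (simp only: if_False)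
qed

definition is_companion :: "('a::complete_lattice \<Rightarrow> 'a) \<Rightarrow> ('a \<Rightarrow> 'a) \<Rightarrow> bool" where
  "is_companion b t \<longleftrightarrow>
    mono t \<and> t \<circ> b \<le> b \<circ> t \<and> (\<forall>s. mono s \<and> s \<circ> b \<le> b \<circ> s \<longrightarrow> s \<le> t)"

end

theory Submission
  imports Defs
begin

text \<open>
  The final sequence is a decreasing chain. It is indexed by more ordinals than the lattice has
  elements, so it takes some value twice and from there on stays at a fixed point of \<open>b\<close>. Hence its
  range is closed under \<open>b\<close> and under all infima, and \<open>t x\<close>, the least member of the chain above
  \<open>x\<close>, is itself some \<open>b\<^sub>i\<close>; then \<open>b x \<le> b (b\<^sub>i)\<close> yields \<open>t (b x) \<le> b (t x)\<close>. Conversely, any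
  monotone \<open>s\<close> with \<open>s \<circ> b \<le> b \<circ> s\<close> satisfies \<open>s (b\<^sub>i) \<le> b\<^sub>i\<close> for all \<open>i\<close>, whence \<open>s \<le> t\<close>.
\<close>

section \<open>Induction over zero, successors and limits in a well-order\<close>

lemma zero_succ_limit_cases:
  fixes i :: "'o::wellorder"
  obtains (zero) "is_zero i" | (succ) j where "is_succ_of i j" | (limit) "is_limit i"
  unfolding is_limit_def by blast

lemma less_if_is_succ_of: "is_succ_of i j \<Longrightarrow> j < i"
  by (simp add: is_succ_of_def)

lemma zero_succ_limit_induct [case_names zero succ limit]:
  fixes i :: "'o::wellorder"
  assumes "\<And>i. is_zero i \<Longrightarrow> P i"
    and "\<And>i j. is_succ_of i j \<Longrightarrow> P j \<Longrightarrow> P i"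
    and "\<And>i. is_limit i \<Longrightarrow> (\<And>j. j < i \<Longrightarrow> P j) \<Longrightarrow> P i"
  shows "P i"
proof (induction i rule: less_induct)
  case (less i)
  then show ?case
    by (cases i rule: zero_succ_limit_cases) (use assms less_if_is_succ_of in blast)+
qed

lemma ex_is_succ_of:
  fixes j k :: "'o::wellorder"
  assumes "j < k"
  obtains i where "is_succ_of i j" "i \<le> k"
proof
  show "is_succ_of (LEAST i. j < i) j"
    unfolding is_succ_of_def using LeastI[of "\<lambda>i. j < i", OF assms] by (auto intro: Least_le)
  show "(LEAST i. j < i) \<le> k"
    using assms by (rule Least_le)
qed

section \<open>Descent of the final sequence and its lower bounds\<close>

lemma final_seq_decreasing:
  assumes "mono b"
  shows "b (final_seq b i) \<le> final_seq b i"
proof (induction i rule: zero_succ_limit_induct)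
  case (limit i)
  have "b (final_seq b i) \<le> final_seq b j" if "j < i" for j
  proof -
    have "final_seq b i \<le> final_seq b j"
      unfolding final_seq_limit[OF limit(1)] using that by (auto intro: INF_lower)
    then show ?thesis
      using limit(2)[OF that] monoD[OF assms] by (meson order_trans)
  qed
  then show ?case
    by (subst (2) final_seq_limit[OF limit(1)]) (auto intro: INF_greatest)
qed (auto simp: final_seq_zero final_seq_succ monoD[OF assms])

lemma final_seq_antimono:
  assumes "mono b" and "i \<le> j"
  shows "final_seq b j \<le> final_seq b i"
  using assms(2)
proof (induction j rule: zero_succ_limit_induct)
  case (zero j)
  then show ?case
    by (metis is_zero_def order_antisym order_refl)
next
  case (succ j k)
  show ?case
  proof (cases "i = j")
    case False
    then have "i \<le> k"
      using succ(1,3) unfolding is_succ_of_def by (meson leD leI order_antisym)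
    then show ?thesis
      using succ(1,2) final_seq_decreasing[OF assms(1), of k]
      by (auto simp: final_seq_succ intro: order_trans)
  qed simp
next
  case (limit j)
  then show ?case
    by (cases "i = j") (auto simp: final_seq_limit[OF limit(1)] intro: INF_lower)
qed

text \<open>Applied to a fixed point occurring in the sequence, this makes it the least value of the
  sequence.\<close>

lemma postfixpoint_le_final_seq:
  assumes "mono b" and "x \<le> b x"
  shows "x \<le> final_seq b i"
proof (induction i rule: zero_succ_limit_induct)
  case (succ i j)
  then show ?case
    using assms by (metis final_seq_succ monoD order_trans)
qed (auto simp: final_seq_zero final_seq_limit intro: INF_greatest)

section \<open>Stabilisation and closure of the range\<close>

lemma final_seq_fixpoint_if_not_inj:
  fixes b :: "'a::complete_lattice \<Rightarrow> 'a"
  assumes "mono b" and "\<not> inj (final_seq b :: 'o::wellorder \<Rightarrow> 'a)"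
  obtains k :: "'o::wellorder" where "b (final_seq b k) = final_seq b k"
proof -
  from assms(2) obtain i j :: 'o where "i < j" and eq: "final_seq b i = final_seq b j"
    unfolding inj_def by (metis linorder_neqE)
  \<comment> \<open>The value at \<open>s\<close> is \<open>b (final_seq b i)\<close>; since
    \<open>s \<le> j\<close>, it lies above the repeated value at \<open>j\<close>.\<close>
  then obtain s where s: "is_succ_of s i" "s \<le> j"
    using ex_is_succ_of by blast
  then have "final_seq b i \<le> b (final_seq b i)"
    using final_seq_antimono[OF assms(1) s(2)] eq by (simp add: final_seq_succ)
  then show thesis
    using that final_seq_decreasing[OF assms(1)] order_antisym by blast
qed

text \<open>The successor of \<open>i\<close> serves as \<open>j\<close>, unless \<open>i\<close> is
  the greatest index. In that case the sequence has already reached its fixed point at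
  \<open>i\<close>, so \<open>i\<close> itself serves.\<close>

lemma final_seq_range_closed:
  fixes b :: "'a::complete_lattice \<Rightarrow> 'a" and i :: "'o::wellorder"
  assumes "mono b" and "\<not> inj (final_seq b :: 'o::wellorder \<Rightarrow> 'a)"
  obtains j :: "'o::wellorder" where "final_seq b j = b (final_seq b i)"
proof (cases "\<exists>k. i < k")
  case True
  then show thesis
    using that ex_is_succ_of final_seq_succ by metis
next
  case False
  obtain k :: 'o where k: "b (final_seq b k) = final_seq b k"
    using assms by (rule final_seq_fixpoint_if_not_inj)
  have "final_seq b i \<le> final_seq b k"
    using False assms(1) by (auto intro: final_seq_antimono simp: not_less)
  moreover have "final_seq b k \<le> final_seq b i"
    using k by (intro postfixpoint_le_final_seq assms(1)) simp
  ultimately show thesis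
    using that[of i] k by (simp add: order_antisym)
qed

text \<open>If \<open>J\<close> is bounded, the infimum is the value at the supremum of
  \<open>J\<close>; for empty \<open>J\<close> this is the value \<open>top\<close> at zero. If
  \<open>J\<close> is unbounded, it reaches past an index of the fixed point, which is then the
  infimum.\<close>

lemma final_seq_Inf_closed:
  fixes b :: "'a::complete_lattice \<Rightarrow> 'a" and J :: "'o::wellorder set"
  assumes "mono b" and "\<not> inj (final_seq b :: 'o::wellorder \<Rightarrow> 'a)"
  obtains j :: "'o::wellorder" where "final_seq b j = (INF i\<in>J. final_seq b i)"
proof (cases "\<exists>j. \<forall>i\<in>J. i \<le> j")
  case True
  define j where "j = (LEAST j. \<forall>i\<in>J. i \<le> j)"
  have ub: "\<forall>i\<in>J. i \<le> j"
    unfolding j_def using True by (rule LeastI_ex)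
  have least: "\<exists>i\<in>J. l < i" if "l < j" for l
    using not_less_Least[OF that[unfolded j_def]] by (auto simp: not_le)
  have "(INF i\<in>J. final_seq b i) \<le> final_seq b j"
  proof (cases j rule: zero_succ_limit_cases)
    case zero
    then show ?thesis by (simp add: final_seq_zero)
  next
    case (succ k)
    \<comment> \<open>A supremum that is a successor is attained: a member of \<open>J\<close> above
      \<open>k\<close> is at least \<open>j\<close>.\<close>
    then obtain i where "i \<in> J" "k < i"
      using least less_if_is_succ_of by blast
    then have "j \<in> J"
      using succ ub unfolding is_succ_of_def by (metis order_antisym)
    then show ?thesis by (rule INF_lower)
  next
    case limit
    \<comment> \<open>\<open>J\<close> has members above every \<open>l < j\<close>, and the
      sequence is decreasing.\<close>
    have "(INF i\<in>J. final_seq b i) \<le> final_seq b l" if "l < j" for l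
      using least[OF that] final_seq_antimono[OF assms(1)] by (meson INF_lower2 less_imp_le)
    then show ?thesis
      by (auto simp: final_seq_limit[OF limit] intro: INF_greatest)
  qed
  moreover have "final_seq b j \<le> (INF i\<in>J. final_seq b i)"
    using ub final_seq_antimono[OF assms(1)] by (auto intro: INF_greatest)
  ultimately show thesis
    using that order_antisym by blast
next
  case False
  obtain k :: 'o where k: "b (final_seq b k) = final_seq b k"
    using assms by (rule final_seq_fixpoint_if_not_inj)
  obtain i where "i \<in> J" "k \<le> i"
    using False by (meson linear)
  then have "(INF i\<in>J. final_seq b i) \<le> final_seq b k"
    using final_seq_antimono[OF assms(1)] by (meson INF_lower2)
  moreover have "final_seq b k \<le> (INF i\<in>J. final_seq b i)"
    using k by (intro INF_greatest postfixpoint_le_final_seq assms(1)) simp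
  ultimately show thesis
    using that order_antisym by blast
qed

section \<open>Distributive laws and the companion\<close>

lemma distributive_law_final_seq_le:
  assumes "mono b" "mono s" and "s \<circ> b \<le> b \<circ> s"
  shows "s (final_seq b i) \<le> final_seq b i"
proof (induction i rule: zero_succ_limit_induct)
  case (succ i j)
  have "s (b (final_seq b j)) \<le> b (s (final_seq b j))"
    using assms(3) by (simp add: le_fun_def)
  also have "\<dots> \<le> b (final_seq b j)"
    using assms(1) succ(2) by (rule monoD)
  finally show ?case
    by (simp add: final_seq_succ[OF succ(1)])
next
  case (limit i)
  have "s (final_seq b i) \<le> final_seq b j" if "j < i" for j
    using monoD[OF assms(2) final_seq_antimono[OF assms(1) less_imp_le[OF that]]] limit(2)[OF that]
    by (rule order_trans)
  then show ?case
    by (subst (2) final_seq_limit[OF limit(1)]) (auto intro: INF_greatest)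
qed (simp add: final_seq_zero)

lemma is_companion_Inf_final_seq:
  fixes b :: "'a::complete_lattice \<Rightarrow> 'a"
  assumes "mono b" and "\<not> inj (final_seq b :: 'o::wellorder \<Rightarrow> 'a)"
  shows "is_companion b (\<lambda>x. Inf {final_seq b i | i :: 'o. x \<le> final_seq b i})"
proof -
  define t where "t x = Inf {final_seq b i | i :: 'o. x \<le> final_seq b i}" for x
  have t_le: "t x \<le> final_seq b i" if "x \<le> final_seq b i" for x and i :: 'o
    unfolding t_def using that by (auto intro: Inf_lower)
  have le_t: "y \<le> t x" if "\<And>i :: 'o. x \<le> final_seq b i \<Longrightarrow> y \<le> final_seq b i" for x y
    unfolding t_def using that by (auto intro: Inf_greatest)
  have "mono t"
    by (intro monoI le_t t_le) (rule order_trans)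
  moreover have "t (b x) \<le> b (t x)" for x
  proof -
    obtain i :: 'o where "final_seq b i = (INF i\<in>{i :: 'o. x \<le> final_seq b i}. final_seq b i)"
      using assms by (rule final_seq_Inf_closed)
    then have i: "t x = final_seq b i"
      by (simp add: t_def setcompr_eq_image)
    obtain j :: 'o where j: "final_seq b j = b (final_seq b i)"
      using assms by (rule final_seq_range_closed)
    \<comment> \<open>As \<open>b (t x)\<close> is the value at \<open>j\<close>, this puts it among
      the elements whose infimum is \<open>t (b x)\<close>.\<close>
    have "b x \<le> b (t x)"
      using assms(1) by (auto intro: monoD le_t)
    then show ?thesis
      using t_le[of "b x" j] i j by simp
  qed
  moreover have "s x \<le> t x" if "mono s" "s \<circ> b \<le> b \<circ> s" for s x
  proof (rule le_t)
    fix i :: 'o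
    assume "x \<le> final_seq b i"
    then have "s x \<le> s (final_seq b i)"
      by (rule monoD[OF that(1)])
    also have "\<dots> \<le> final_seq b i"
      using assms(1) that by (rule distributive_law_final_seq_le)
    finally show "s x \<le> final_seq b i" .
  qed
  ultimately have "is_companion b t"
    by (auto simp: is_companion_def le_fun_def)
  then show ?thesis
    by (simp add: t_def[abs_def])
qed

section \<open>Size of the index type\<close>

text \<open>
  Burali-Forti: an injection would transport the order of \<open>'i ordinal\<close> to a well-order on \<open>'i\<close>, whose
  order type would lie above a strictly increasing copy of all of \<open>'i ordinal\<close>.
\<close>

lemma not_inj_ordinal:
  fixes f :: "'i ordinal \<Rightarrow> 'i"
  shows "\<not> inj f"
proof
  assume inj: "inj f"
  define r where "r = {(f x, f y) | x y. x \<le> y}"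
  have r_iff [simp]: "(f x, f y) \<in> r \<longleftrightarrow> x \<le> y" for x y
    unfolding r_def using inj by (auto dest: injD)
  have Field: "Field r = range f"
    unfolding r_def Field_def by auto
  have "wf (r - Id)"
  proof -
    have "r - Id \<subseteq> inv_image {(x, y). x < y} (inv f)"
      unfolding r_def using inj by auto
    then show ?thesis
      by (rule wf_subset[rotated]) (intro wf_inv_image wf)
  qed
  moreover have "refl_on (Field r) r"
    by (auto simp: refl_on_def Field)
  moreover have "r \<subseteq> Field r \<times> Field r"
    by (auto simp: Field_def)
  moreover have "trans r"
    by (rule transI) (auto simp: r_def dest!: injD[OF inj] intro: order_trans)
  moreover have "antisym r"
    by (rule antisymI) (auto simp: r_def dest!: injD[OF inj])
  moreover have "total_on (Field r) r"
    by (auto simp: total_on_def Field linear)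
  ultimately have wo: "Well_order r"
    unfolding well_order_on_def linear_order_on_def partial_order_on_def preorder_on_def by blast
  then interpret wo_rel r
    by (simp add: wo_rel_def)
  have ofilter: "ofilter (f ` {..<x})" for x
    unfolding ofilter_def under_def Field by (auto simp: r_def dest!: injD[OF inj])
  \<comment> \<open>The order type of the proper initial segment of \<open>r\<close> below
    \<open>f x\<close>.\<close>
  define g where "g x = abs_ordinal (Restr r (f ` {..<x}))" for x
  have refl: "(Restr r A, Restr r A) \<in> ordIso" for A
    using wo by (intro ordIso_reflexive Well_order_Restr)
  have "g x < g y" if "x < y" for x y
  proof -
    have "f ` {..<x} \<subset> f ` {..<y}"
      using that inj by (auto simp: psubset_eq inj_image_subset_iff inj_image_eq_iff)
    then show ?thesis
      unfolding g_def less_ordinal.abs_eq[OF refl refl]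
      using ofilter_subset_ordLess[OF wo ofilter ofilter] by blast
  qed
  moreover have "g x < abs_ordinal r" for x
  proof -
    have "f x \<in> Field r" "f x \<notin> f ` {..<x}"
      using inj by (auto simp: Field dest: injD)
    then have "f ` {..<x} \<noteq> Field r"
      by blast
    then show ?thesis
      unfolding g_def less_ordinal.abs_eq[OF refl ordIso_reflexive[OF wo]]
      using ofilter_ordLess[OF wo ofilter] Field by blast
  qed
  \<comment> \<open>A strictly increasing self-map of a well-order never falls below the identity.
    At \<open>x = abs_ordinal r\<close> this contradicts \<open>g x < abs_ordinal r\<close>.\<close>
  moreover have "x \<le> g x" for x
  proof (induction x rule: less_induct)
    case (less x)
    show ?case
    proof (rule ccontr)
      assume "\<not> x \<le> g x"
      then have "g x < x" by simp
      then show False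
        using less[of "g x"] \<open>\<And>x y. x < y \<Longrightarrow> g x < g y\<close>[of "g x" x] by simp
    qed
  qed
  ultimately show False
    using leD by blast
qed

theorem theorem7p1:
  fixes b :: "'a::complete_lattice \<Rightarrow> 'a"
  assumes "mono b"
  shows "is_companion b
    (\<lambda>x. Inf {final_seq b i | i :: ('a + 'i) ordinal. x \<le> final_seq b i})"
proof (rule is_companion_Inf_final_seq[OF assms])
  show "\<not> inj (final_seq b :: ('a + 'i) ordinal \<Rightarrow> 'a)"
    \<comment> \<open>\<open>Inl\<close> embeds the lattice into \<open>'a + 'i\<close>, the type
      whose well-orders supply the indices.\<close>
    using not_inj_ordinal[of "Inl \<circ> final_seq b"] by (auto intro: inj_compose)
qed

end
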